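(* Let $G(n,m)=(V_\alpha\cup V_\beta,E)$ be a bipartite graph with $m\ge n$. For each integer $\ell\ge0$, let $\bar G(n,m)$ be the associated digraph with capacity function $\bar c_\ell$, and let $\bar F_\ell$ be the set of saturated integer-valued flows on $\bar G(n,m)$ with respect to $\bar c_\ell$. Let $\ell^*:=\max\{\ell\ge0\mid\bar F_\ell\ne\varnothing\}$. Then $\ell^*\le m$ and the following hold: (1) if $\ell^*\ge0$, then $\bar F_\ell\ne\varnothing$ for all $0\le\ell\le\ell^*$, and for any $f\in\bar F_\ell$ the bipartite graph $G_f(n,m)$ induced by $f$ is a union of $\ell$ disjoint left-perfect matchings; (2) the degree of strong resilience of $G(n,m)$ is $\ell^*-1$.
   Context: $G(n,m)=(V_\alpha\cup V_\beta,E)$ is an undirected bipartite graph with left-nodes $V_\alpha=\{\alpha_1,\dots,\alpha_n\}$ and right-nodes $V_\beta=\{\beta_1,\dots,\beta_m\}$. For $m\ge n$, a left-perfect matching is a set of $n$ edges no two of which share a node. A bipartite graph is a union of $\ell$ disjoint left-perfect matchings if its edge set is the union of $\ell$ pairwise (edge-)disjoint left-perfect matchings (for $\ell=0$: the edge set is empty). Digraph and capacity: $\bar G(n,m)=(\bar V,\bar E)$ has $\bar V=V_\alpha\cup V_\beta\cup\{s,t\}$ with two new nodes $s$ (source) and $t$ (target), and $\bar E=\bar E_0\cup\bar E_1$ where $\bar E_0=\{s\alpha_i,\ \beta_jt\mid\alpha_i\in V_\alpha,\beta_j\in V_\beta\}$ and $\bar E_1=\{\alpha_i\beta_j\mid(\alpha_i,\beta_j)\in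 E\}$ (here $uv$ is the directed edge from $u$ to $v$). The capacity is $\bar c_\ell(e)=\ell$ for $e\in\bar E_0$ and $\bar c_\ell(e)=1$ for $e\in\bar E_1$. A flow is a function $f:\bar E\to\mathbb R_{\ge0}$ with $f(e)\le\bar c_\ell(e)$ for all $e$ and $\sum_{u:uv\in\bar E}f(uv)=\sum_{w:vw\in\bar E}f(vw)$ for all $v\ne s,t$. Its value is $|f|=\sum_{v:sv\in\bar E}f(sv)=\sum_{v:vt\in\bar E}f(vt)$. $F_\ell$ is the set of integer-valued flows on $\bar G$ with respect to $\bar c_\ell$. A flow $f\in F_\ell$ is saturated if $|f|=n\ell$; $\bar F_\ell$ is the set of saturated flows in $F_\ell$. For $f\in F_\ell$, $G_f=(V_\alpha\cup V_\beta,E_f)$ with $E_f=\{(\alpha_i,\beta_j)\in E\mid f(\alpha_i\beta_j)\ne0\}$. Strong resilience: a sparsity pattern $\mathcal S(n,m)$ in $\mathbb R^{n\times m}$ is a vector subspace with a basis consisting of matrices $E_{ij}$ ($1$ in entry $(i,j)$, $0$ elsewhere); $E(\mathcal S)$ is the set of pairs $(i,j)$ with $E_{ij}\in\mathcal S$; its rank is the maximal rank of matrices in it. It corresponds to the bipartite graph with edges $(\alpha_i,\beta_j)$, $(i,j)\in E(\mathcal S)$. A pattern of rank $n$ is $0$-resilient if there is a pattern $\mathcal S'$ with $E(\mathcal S')\subset E(\mathcal S)$, $|E(\mathcal S')|=|E(\mathcal S)|-1$, of rank less than $n$. A pattern of rank $n$ has degree of strong resilience $k\ge0$ if it contains a direct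 sum (pairwise disjoint index sets) of $k+1$, but not of $k+2$, $0$-resilient patterns; the degree is $-1$ by convention if the rank is less than $n$. The degree of strong resilience of $G$ is that of the corresponding pattern. *)

theory Defs
  imports "HOL-Analysis.Analysis"
begin

text \<open>
  The left-nodes are the elements of a finite type \<open>'n\<close> and the right-nodes those of a finite
  type \<open>'m\<close>, so that \<open>n = CARD('n)\<close> and \<open>m = CARD('m)\<close>.  As these types are nonempty, \<open>n, m \<ge> 1\<close>.
  A bipartite graph is its edge set \<open>E :: ('n \<times> 'm) set\<close>, where \<open>(i, j) \<in> E\<close> stands for the
  undirected edge between \<open>\<alpha>\<^sub>i\<close> and \<open>\<beta>\<^sub>j\<close>.
\<close>

subsection \<open>Matchings\<close>

definition left_perfect_matching :: "('n::finite \<times> 'm::finite) set \<Rightarrow> ('n \<times> 'm) set \<Rightarrow> bool" where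
  "left_perfect_matching E M \<longleftrightarrow>
     M \<subseteq> E \<and> card M = CARD('n) \<and>
     (\<forall>e\<in>M. \<forall>e'\<in>M. e \<noteq> e' \<longrightarrow> fst e \<noteq> fst e' \<and> snd e \<noteq> snd e')"

definition union_of_disjoint_lpms :: "nat \<Rightarrow> ('n::finite \<times> 'm::finite) set \<Rightarrow> bool" where
  "union_of_disjoint_lpms l E \<longleftrightarrow>
     (\<exists>M :: nat \<Rightarrow> ('n \<times> 'm) set.
        (\<forall>i<l. left_perfect_matching E (M i)) \<and>
        disjoint_family_on M {..<l} \<and>
        E = (\<Union>i<l. M i))"

subsection \<open>Integer flows on the associated digraph\<close>

datatype ('n, 'm) node = Source | Target | Left_Node 'n | Right_Node 'm

instance node :: (finite, finite) finite
proof
  have "x \<in> {Source, Target} \<union> range Left_Node \<union> range Right_Node" for x :: "('a, 'b) node"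
    by (cases x) simp_all
  then have "(UNIV :: ('a, 'b) node set) \<subseteq> {Source, Target} \<union> range Left_Node \<union> range Right_Node"
    by blast
  then show "finite (UNIV :: ('a, 'b) node set)"
    by (rule finite_subset) simp
qed

definition outer_arcs :: "(('n, 'm) node \<times> ('n, 'm) node) set" where
  "outer_arcs = range (\<lambda>i. (Source, Left_Node i)) \<union> range (\<lambda>j. (Right_Node j, Target))"

definition inner_arcs :: "('n \<times> 'm) set \<Rightarrow> (('n, 'm) node \<times> ('n, 'm) node) set" where
  "inner_arcs E = {(Left_Node i, Right_Node j) | i j. (i, j) \<in> E}"

definition arcs :: "('n \<times> 'm) set \<Rightarrow> (('n, 'm) node \<times> ('n, 'm) node) set" where
  "arcs E = outer_arcs \<union> inner_arcs E"

definition capacity :: "nat \<Rightarrow> ('n, 'm) node \<times> ('n, 'm) node \<Rightarrow> real" where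
  "capacity l e = (if e \<in> outer_arcs then real l else 1)"

text \<open>A flow is a function on the arcs only: being an element of \<open>A \<rightarrow>\<^sub>E {0..}\<close>, it is
  \<open>undefined\<close> off the arc set \<open>A\<close>.\<close>

definition is_flow ::
  "('v \<times> 'v) set \<Rightarrow> 'v \<Rightarrow> 'v \<Rightarrow> ('v \<times> 'v \<Rightarrow> real) \<Rightarrow> ('v \<times> 'v \<Rightarrow> real) \<Rightarrow> bool" where
  "is_flow A s t c f \<longleftrightarrow>
     f \<in> A \<rightarrow>\<^sub>E {0..} \<and>
     (\<forall>e\<in>A. f e \<le> c e) \<and>
     (\<forall>v. v \<noteq> s \<and> v \<noteq> t \<longrightarrow>
        (\<Sum>u | (u, v) \<in> A. f (u, v)) = (\<Sum>w | (v, w) \<in> A. f (v, w)))"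

definition flow_value :: "('v \<times> 'v) set \<Rightarrow> 'v \<Rightarrow> ('v \<times> 'v \<Rightarrow> real) \<Rightarrow> real" where
  "flow_value A s f = (\<Sum>v | (s, v) \<in> A. f (s, v))"

definition integer_flows ::
  "('n::finite \<times> 'm::finite) set \<Rightarrow> nat \<Rightarrow> (('n, 'm) node \<times> ('n, 'm) node \<Rightarrow> real) set" where
  "integer_flows E l =
     {f. is_flow (arcs E) Source Target (capacity l) f \<and> (\<forall>e\<in>arcs E. f e \<in> \<int>)}"

definition saturated_flows ::
  "('n::finite \<times> 'm::finite) set \<Rightarrow> nat \<Rightarrow> (('n, 'm) node \<times> ('n, 'm) node \<Rightarrow> real) set" where
  "saturated_flows E l =
     {f \<in> integer_flows E l. flow_value (arcs E) Source f = real (CARD('n) * l)}"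

definition induced_graph ::
  "('n \<times> 'm) set \<Rightarrow> (('n, 'm) node \<times> ('n, 'm) node \<Rightarrow> real) \<Rightarrow> ('n \<times> 'm) set" where
  "induced_graph E f = {(i, j) \<in> E. f (Left_Node i, Right_Node j) \<noteq> 0}"

definition saturated_levels :: "('n::finite \<times> 'm::finite) set \<Rightarrow> nat set" where
  "saturated_levels E = {l. saturated_flows E l \<noteq> {}}"

definition ell_star :: "('n::finite \<times> 'm::finite) set \<Rightarrow> nat" where
  "ell_star E = Max (saturated_levels E)"

subsection \<open>Sparsity patterns and strong resilience\<close>

definition unit_matrix :: "'n::finite \<times> 'm::finite \<Rightarrow> real^'m^'n" where
  "unit_matrix p = (\<chi> i j. if (i, j) = p then 1 else 0)"

definition sparsity_pattern :: "(real^'m^'n) set \<Rightarrow> bool" where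
  "sparsity_pattern S \<longleftrightarrow>
     subspace S \<and> (\<exists>B \<subseteq> range unit_matrix. independent B \<and> span B = S)"

definition index_set :: "(real^'m^'n) set \<Rightarrow> ('n::finite \<times> 'm::finite) set" where
  "index_set S = {p. unit_matrix p \<in> S}"

definition pattern_rank :: "(real^'m^'n) set \<Rightarrow> nat" where
  "pattern_rank S = Max (rank ` S)"

definition zero_resilient :: "(real^'m^'n) set \<Rightarrow> bool" where
  "zero_resilient S \<longleftrightarrow>
     sparsity_pattern S \<and> pattern_rank S = CARD('n) \<and>
     (\<exists>S'. sparsity_pattern S' \<and> index_set S' \<subseteq> index_set S \<and>
           card (index_set S') + 1 = card (index_set S) \<and> pattern_rank S' < CARD('n))"

definition contains_zero_resilient_sum :: "nat \<Rightarrow> (real^'m^'n) set \<Rightarrow> bool" where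
  "contains_zero_resilient_sum q S \<longleftrightarrow>
     (\<exists>P :: nat \<Rightarrow> (real^'m^'n) set.
        (\<forall>i<q. zero_resilient (P i)) \<and>
        disjoint_family_on (\<lambda>i. index_set (P i)) {..<q} \<and>
        {\<Sum>i<q. x i | x. \<forall>i<q. x i \<in> P i} \<subseteq> S)"

text \<open>The degree is rendered as a relation, so that asserting it includes the existence of the
  degree; it is single-valued by \<open>strong_resilience_degree_unique\<close> below.\<close>

definition has_strong_resilience_degree :: "(real^'m^'n) set \<Rightarrow> int \<Rightarrow> bool" where
  "has_strong_resilience_degree S d \<longleftrightarrow>
     (if pattern_rank S < CARD('n) then d = -1
      else d \<ge> 0 \<and> contains_zero_resilient_sum (nat d + 1) S \<and>
           \<not> contains_zero_resilient_sum (nat d + 2) S)"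

definition pattern_of_graph :: "('n::finite \<times> 'm::finite) set \<Rightarrow> (real^'m^'n) set" where
  "pattern_of_graph E = span (unit_matrix ` E)"

definition graph_has_strong_resilience_degree :: "('n::finite \<times> 'm::finite) set \<Rightarrow> int \<Rightarrow> bool" where
  "graph_has_strong_resilience_degree E d \<longleftrightarrow> has_strong_resilience_degree (pattern_of_graph E) d"

lemma contains_zero_resilient_sum_mono:
  assumes "contains_zero_resilient_sum r S" "q \<le> r"
  shows "contains_zero_resilient_sum q S"
proof -
  obtain P where P: "\<forall>i<r. zero_resilient (P i)"
      "disjoint_family_on (\<lambda>i. index_set (P i)) {..<r}"
      "{\<Sum>i<r. x i | x. \<forall>i<r. x i \<in> P i} \<subseteq> S"
    using assms(1) unfolding contains_zero_resilient_sum_def by blast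
  have "{\<Sum>i<q. x i | x. \<forall>i<q. x i \<in> P i} \<subseteq> {\<Sum>i<r. x i | x. \<forall>i<r. x i \<in> P i}"
  proof clarify
    fix x assume x: "\<forall>i<q. x i \<in> P i"
    define y where "y i = (if i < q then x i else 0)" for i
    have "(\<Sum>i<q. x i) = (\<Sum>i<r. y i)"
      by (rule sum.mono_neutral_cong_left) (use assms(2) in \<open>auto simp: y_def\<close>)
    moreover have "\<forall>i<r. y i \<in> P i"
      using x P(1) by (auto simp: y_def zero_resilient_def sparsity_pattern_def subspace_0)
    ultimately show "\<exists>y. (\<Sum>i<q. x i) = (\<Sum>i<r. y i) \<and> (\<forall>i<r. y i \<in> P i)"
      by blast
  qed
  moreover have "disjoint_family_on (\<lambda>i. index_set (P i)) {..<q}"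
    using P(2) assms(2) by (auto simp: disjoint_family_on_def)
  ultimately show ?thesis
    using P assms(2) unfolding contains_zero_resilient_sum_def
    by (intro exI[of _ P]) auto
qed

lemma strong_resilience_degree_unique:
  fixes S :: "(real^'m^'n) set"
  assumes "has_strong_resilience_degree S d" "has_strong_resilience_degree S d'"
  shows "d = d'"
proof -
  have *: False if "has_strong_resilience_degree S a" "has_strong_resilience_degree S b" "a < b" for a b
  proof (cases "pattern_rank S < CARD('n)")
    case True
    then show ?thesis using that by (simp add: has_strong_resilience_degree_def)
  next
    case False
    then have "\<not> contains_zero_resilient_sum (nat a + 2) S"
        "contains_zero_resilient_sum (nat b + 1) S" "nat a + 2 \<le> nat b + 1"
      using that by (auto simp: has_strong_resilience_degree_def)
    then show ?thesis using contains_zero_resilient_sum_mono by blast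
  qed
  show ?thesis using *[of d d'] *[of d' d] assms by (cases d d' rule: linorder_cases) auto
qed

lemma inj_unit_matrix: "inj unit_matrix"
  by (rule injI) (auto simp: unit_matrix_def vec_eq_iff split: if_splits)

lemma index_set_pattern_of_graph: "index_set (pattern_of_graph E) = E"
proof -
  have "unit_matrix p \<notin> span (unit_matrix ` E)" if "p \<notin> E" for p
  proof
    assume "unit_matrix p \<in> span (unit_matrix ` E)"
    moreover have "span (unit_matrix ` E) \<subseteq> {A. A $ fst p $ snd p = 0}"
      using that by (intro span_minimal) (auto simp: unit_matrix_def subspace_def)
    ultimately show False by (auto simp: unit_matrix_def)
  qed
  then show ?thesis
    by (auto simp: index_set_def pattern_of_graph_def intro: span_base)
qed

lemma sparsity_pattern_pattern_of_graph: "sparsity_pattern (pattern_of_graph E)"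
proof -
  have "independent (unit_matrix ` E)"
  proof (clarsimp simp: dependent_def)
    fix i j assume ij: "(i, j) \<in> E" "unit_matrix (i, j) \<in> span (unit_matrix ` E - {unit_matrix (i, j)})"
    have "unit_matrix ` E - {unit_matrix (i, j)} = unit_matrix ` (E - {(i, j)})"
      using inj_unit_matrix by (auto dest: injD)
    then have "(i, j) \<in> index_set (pattern_of_graph (E - {(i, j)}))"
      using ij by (simp add: index_set_def pattern_of_graph_def)
    then show False by (simp add: index_set_pattern_of_graph)
  qed
  then show ?thesis
    unfolding sparsity_pattern_def pattern_of_graph_def 
    by (intro conjI subspace_span exI[of _ "unit_matrix ` E"]) auto
qed

lemma pattern_of_graph_unique:
  assumes "sparsity_pattern S" "index_set S = E"
  shows "S = pattern_of_graph E"
proof -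
  obtain B where B: "B \<subseteq> range unit_matrix" "span B = S" and S: "subspace S"
    using assms(1) by (auto simp: sparsity_pattern_def)
  have "B \<subseteq> unit_matrix ` E"
    using B assms(2) by (auto simp: index_set_def intro: span_base)
  then have "S \<subseteq> pattern_of_graph E"
    using B(2) span_mono unfolding pattern_of_graph_def by blast
  moreover have "pattern_of_graph E \<subseteq> S"
    unfolding pattern_of_graph_def
    by (rule span_minimal) (use S assms(2) in \<open>auto simp: index_set_def\<close>)
  ultimately show ?thesis by blast
qed

end

theory Submission
  imports Defs
begin

text \<open>
  The levels of saturated flows and the degree of strong resilience measure the same quantity: the
  largest number of pairwise disjoint left-perfect matchings that fit into the graph.

  \<^emph>\<open>Flows.\<close> An integer flow takes only the values 0 and 1 on the inner arcs, so it amounts to the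
  subgraph \<open>H\<close> of edges on which it is nonzero, and its values on the outer arcs are the degrees of
  \<open>H\<close>. Its value is \<open>n * l\<close> exactly if every left-node has degree \<open>l\<close> in \<open>H\<close>; the
  capacities at the target say that every right-node has degree at most \<open>l\<close>. Koenig's theorem
  (\<open>bipartite_edge_coloring\<close>) colours the edges of such an \<open>H\<close> properly with \<open>l\<close> colours. Each
  left-node then sees every colour, so the colour classes are \<open>l\<close> disjoint left-perfect matchings
  (\<open>union_of_disjoint_lpms_iff_degrees\<close>). As some of the matchings may be dropped, the levels
  that admit a saturated flow form an initial segment of the natural numbers; the left degrees bound
  it by the number of right-nodes.

  \<^emph>\<open>Patterns.\<close> A matrix of full row rank has a nonzero transversal, by the Leibniz expansion of
  a nonzero minor; so a pattern has rank \<open>n\<close> exactly if its index set contains a left-perfect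
  matching (\<open>pattern_rank_full_iff\<close>). A single left-perfect matching spans a 0-resilient pattern,
  since it cannot lose an edge. Therefore a direct sum of \<open>q\<close> 0-resilient patterns fits into the
  pattern of the graph exactly if \<open>q\<close> disjoint left-perfect matchings fit into the graph
  (\<open>contains_zero_resilient_sum_iff\<close>), that is, if \<open>q \<le> ell_star E\<close>.
\<close>

section \<open>Edge colourings of bipartite graphs\<close>

definition proper_edge_coloring :: "nat \<Rightarrow> ('a \<times> 'b) set \<Rightarrow> ('a \<times> 'b \<Rightarrow> nat) \<Rightarrow> bool" where
  "proper_edge_coloring l H c \<longleftrightarrow>
     (\<forall>e\<in>H. c e < l) \<and>
     (\<forall>x y z. (x, y) \<in> H \<longrightarrow> (x, z) \<in> H \<longrightarrow> c (x, y) = c (x, z) \<longrightarrow> y = z) \<and>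
     (\<forall>x y z. (x, z) \<in> H \<longrightarrow> (y, z) \<in> H \<longrightarrow> c (x, z) = c (y, z) \<longrightarrow> x = y)"

lemma proper_edge_coloringD:
  assumes "proper_edge_coloring l H c"
  shows "e \<in> H \<Longrightarrow> c e < l"
    and "(x, y) \<in> H \<Longrightarrow> (x, z) \<in> H \<Longrightarrow> c (x, y) = c (x, z) \<Longrightarrow> y = z"
    and "(x, z) \<in> H \<Longrightarrow> (w, z) \<in> H \<Longrightarrow> c (x, z) = c (w, z) \<Longrightarrow> x = w"
  using assms unfolding proper_edge_coloring_def by blast+

text \<open>
  The step that makes room for a new edge \<open>uv\<close> when \<open>a\<close> is free at \<open>u\<close> and \<open>b\<close> is free at \<open>v\<close>:
  exchange \<open>a\<close> and \<open>b\<close> along the path from \<open>v\<close> whose edges are coloured \<open>a, b, a, \<dots>\<close>.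
  It arrives at left-nodes by an edge of colour \<open>a\<close> and so never reaches \<open>u\<close>. Instead of the path itself
  the proof uses the set \<open>R\<close> of its right-nodes; each edge on the path has its right end in \<open>R\<close>, so
  the exchange is applied to all edges that end in \<open>R\<close>.
\<close>

lemma kempe_swap:
  assumes c: "proper_edge_coloring l H c" and "a < l" "b < l"
    and u: "\<And>y. (u, y) \<in> H \<Longrightarrow> c (u, y) \<noteq> a"
    and v: "\<And>x. (x, v) \<in> H \<Longrightarrow> c (x, v) \<noteq> b"
  shows "\<exists>c'. proper_edge_coloring l H c' \<and>
              (\<forall>y. (u, y) \<in> H \<longrightarrow> c' (u, y) \<noteq> a) \<and> (\<forall>x. (x, v) \<in> H \<longrightarrow> c' (x, v) \<noteq> a)"
proof -
  note D = proper_edge_coloringD[OF c]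
  define step where "step = {(y, z). \<exists>x. (x, y) \<in> H \<and> c (x, y) = a \<and> (x, z) \<in> H \<and> c (x, z) = b}"
  define R where "R = step\<^sup>* `` {v}"
  define c' where "c' = (\<lambda>(x, y). if y \<in> R then Transposition.transpose a b (c (x, y)) else c (x, y))"
  have vR: "v \<in> R" by (simp add: R_def)
  have forward: "z \<in> R" if "y \<in> R" "(x, y) \<in> H" "c (x, y) = a" "(x, z) \<in> H" "c (x, z) = b" for x y z
  proof -
    have "(y, z) \<in> step" using that by (auto simp: step_def)
    then show ?thesis using \<open>y \<in> R\<close> unfolding R_def by (auto intro: rtrancl_into_rtrancl)
  qed
  have backward: "\<exists>y\<in>R. (x, y) \<in> H \<and> c (x, y) = a"
    if "z \<in> R" "(x, z) \<in> H" "c (x, z) = b" for x z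
  proof -
    have "(v, z) \<in> step\<^sup>*" using \<open>z \<in> R\<close> by (simp add: R_def)
    then show ?thesis
    proof (cases rule: rtranclE)
      case base
      then show ?thesis using v that by blast
    next
      case (step y)
      then obtain x' where x': "(x', y) \<in> H" "c (x', y) = a" "(x', z) \<in> H" "c (x', z) = b"
        by (auto simp: step_def)
      have "x' = x" using D(3)[OF x'(3) that(2)] x'(4) that(3) by simp
      moreover have "y \<in> R" using step by (simp add: R_def)
      ultimately show ?thesis using x' by blast
    qed
  qed
  \<comment> \<open>The recolouring is injective at each right-node, so a clash could arise only between two edges
    at a common left-node of which exactly one ends in \<open>R\<close>.\<close>
  have cross: False
    if xyz: "y \<in> R" "z \<notin> R" "(x, y) \<in> H" "(x, z) \<in> H" "c' (x, y) = c' (x, z)" for x y z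
  proof -
    have eq: "Transposition.transpose a b (c (x, y)) = c (x, z)"
      using that by (simp add: c'_def)
    consider "c (x, y) = a" | "c (x, y) = b" | "c (x, y) \<noteq> a" "c (x, y) \<noteq> b" by blast
    then show False
    proof cases
      case 1
      then show False using eq forward[OF xyz(1,3) 1 xyz(4)] xyz(2) by auto
    next
      case 2
      then obtain y' where "y' \<in> R" "(x, y') \<in> H" "c (x, y') = a"
        using backward[OF xyz(1,3)] by blast
      then show False using D(2)[of x y' z] eq 2 xyz by auto
    next
      case 3
      then show False using D(2)[of x y z] eq xyz by (auto simp: transpose_apply_other)
    qed
  qed
  have inj: "Transposition.transpose a b r = Transposition.transpose a b s \<longleftrightarrow> r = s" for r s
    by (metis transpose_involutory)
  have "proper_edge_coloring l H c'"
    unfolding proper_edge_coloring_def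
  proof (intro conjI allI impI ballI)
    fix e assume "e \<in> H"
    then show "c' e < l"
      using D(1)[of e] \<open>a < l\<close> \<open>b < l\<close>
      by (auto simp: c'_def Transposition.transpose_def split: prod.splits)
  next
    fix x y z assume xyz: "(x, y) \<in> H" "(x, z) \<in> H" "c' (x, y) = c' (x, z)"
    show "y = z"
    proof (cases "y \<in> R \<longleftrightarrow> z \<in> R")
      case True
      then have "c (x, y) = c (x, z)" using xyz(3) by (auto simp: c'_def inj split: if_splits)
      then show ?thesis using D(2) xyz by blast
    next
      case False
      then show ?thesis using cross[of y z x] cross[of z y x] xyz by auto
    qed
  next
    fix x y z assume xyz: "(x, z) \<in> H" "(y, z) \<in> H" "c' (x, z) = c' (y, z)"
    then have "c (x, z) = c (y, z)" by (auto simp: c'_def inj split: if_splits)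
    then show "x = y" using D(3) xyz by blast
  qed
  moreover have "c' (u, y) \<noteq> a" if "(u, y) \<in> H" for y
  proof
    assume eq: "c' (u, y) = a"
    then have "y \<in> R" "c (u, y) = b"
      using u[OF that] by (auto simp: c'_def Transposition.transpose_def split: if_splits)
    then show False using backward[OF _ that] u by blast
  qed
  moreover have "c' (x, v) \<noteq> a" if "(x, v) \<in> H" for x
    using v[OF that] vR by (auto simp: c'_def Transposition.transpose_def split: if_splits)
  ultimately show ?thesis by blast
qed

lemma ex_free_color:
  assumes "finite F" "card F < l"
  shows "\<exists>a<l. \<forall>x\<in>F. g x \<noteq> (a::nat)"
proof -
  have "\<not> {..<l} \<subseteq> g ` F"
  proof
    assume "{..<l} \<subseteq> g ` F"
    then have "l \<le> card (g ` F)" using card_mono[of "g ` F" "{..<l}"] assms(1) by simp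
    then show False using card_image_le[OF assms(1), of g] assms(2) by linarith
  qed
  then show ?thesis by blast
qed

text \<open>
  Koenig's edge colouring theorem, by adding one edge at a time: before \<open>uv\<close> is added, both its
  ends have degree less than \<open>l\<close> and hence a free colour, and a swap makes the two free colours agree.
\<close>

theorem bipartite_edge_coloring:
  assumes "finite H"
    and "\<And>x. card (H `` {x}) \<le> l" and "\<And>y. card (H\<inverse> `` {y}) \<le> l"
  shows "\<exists>c. proper_edge_coloring l H c"
  using assms
proof (induction H rule: finite_induct)
  case empty
  then show ?case by (simp add: proper_edge_coloring_def)
next
  case (insert e H)
  obtain u v where e: "e = (u, v)" by (cases e)
  have fin: "finite (H `` {x})" "finite (H\<inverse> `` {y})" for x y
    using insert.hyps(1) by (auto intro: finite_Image)
  have "insert e H `` {u} = insert v (H `` {u})" "v \<notin> H `` {u}"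
    using insert.hyps(2) by (auto simp: e)
  then have du: "card (H `` {u}) < l" using insert.prems(1)[of u] fin by simp
  have "(insert e H)\<inverse> `` {v} = insert u (H\<inverse> `` {v})" "u \<notin> H\<inverse> `` {v}"
    using insert.hyps(2) by (auto simp: e)
  then have dv: "card (H\<inverse> `` {v}) < l" using insert.prems(2)[of v] fin by simp
  have "card (H `` {x}) \<le> l" for x
    using insert.prems(1)[of x] insert.hyps(1)
    by (meson Image_mono card_mono finite.insertI finite_Image le_trans order_refl subset_insertI)
  moreover have "card (H\<inverse> `` {y}) \<le> l" for y
    using insert.prems(2)[of y] insert.hyps(1)
    by (meson Image_mono card_mono converse_mono finite.insertI finite_Image finite_converse le_trans
        order_refl subset_insertI)
  ultimately obtain c where c: "proper_edge_coloring l H c" using insert.IH by blast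
  obtain a where a: "a < l" "\<And>y. (u, y) \<in> H \<Longrightarrow> c (u, y) \<noteq> a"
    using ex_free_color[OF fin(1) du, of "\<lambda>y. c (u, y)"] by auto
  obtain b where b: "b < l" "\<And>x. (x, v) \<in> H \<Longrightarrow> c (x, v) \<noteq> b"
    using ex_free_color[OF fin(2) dv, of "\<lambda>x. c (x, v)"] by auto
  obtain c' where c': "proper_edge_coloring l H c'"
      "\<And>y. (u, y) \<in> H \<Longrightarrow> c' (u, y) \<noteq> a" "\<And>x. (x, v) \<in> H \<Longrightarrow> c' (x, v) \<noteq> a"
    using kempe_swap[OF c a(1) b(1) a(2) b(2)] by blast
  note D = proper_edge_coloringD[OF c'(1)]
  have "proper_edge_coloring l (insert e H) (c'(e := a))"
    unfolding proper_edge_coloring_def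
  proof (intro conjI allI impI ballI)
    fix e' assume "e' \<in> insert e H"
    then show "(c'(e := a)) e' < l" using D(1)[of e'] a(1) by auto
  next
    fix x y z
    assume "(x, y) \<in> insert e H" "(x, z) \<in> insert e H" "(c'(e := a)) (x, y) = (c'(e := a)) (x, z)"
    then show "y = z" using D(2)[of x y z] c'(2) by (auto simp: e split: if_splits)
  next
    fix x y z
    assume "(x, z) \<in> insert e H" "(y, z) \<in> insert e H" "(c'(e := a)) (x, z) = (c'(e := a)) (y, z)"
    then show "x = y" using D(3)[of x z y] c'(3) by (auto simp: e split: if_splits)
  qed
  then show ?case by blast
qed

section \<open>Disjoint left-perfect matchings and degrees\<close>

lemma left_perfect_matching_iff:
  fixes E :: "('n::finite \<times> 'm::finite) set"
  shows "left_perfect_matching E M \<longleftrightarrow> M \<subseteq> E \<and> (\<exists>\<sigma>. inj \<sigma> \<and> M = range (\<lambda>i. (i, \<sigma> i)))"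
proof
  assume M: "left_perfect_matching E M"
  then have inj: "inj_on fst M" "inj_on snd M" and card: "card M = CARD('n)"
    by (auto simp: left_perfect_matching_def inj_on_def)
  have "fst ` M = UNIV"
    by (rule card_subset_eq) (simp_all add: card_image[OF inj(1)] card)
  have "\<exists>j. (i, j) \<in> M" for i
  proof -
    have "i \<in> fst ` M" using \<open>fst ` M = UNIV\<close> by simp
    then show ?thesis by force
  qed
  then obtain \<sigma> where \<sigma>: "\<And>i. (i, \<sigma> i) \<in> M" by metis
  have "M = range (\<lambda>i. (i, \<sigma> i))"
  proof
    show "M \<subseteq> range (\<lambda>i. (i, \<sigma> i))"
    proof
      fix e assume "e \<in> M"
      then have "e = (fst e, \<sigma> (fst e))" using inj_onD[OF inj(1), of e "(fst e, \<sigma> (fst e))"] \<sigma> by simp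
      then show "e \<in> range (\<lambda>i. (i, \<sigma> i))" by blast
    qed
  qed (use \<sigma> in auto)
  moreover have "inj \<sigma>"
    by (rule injI) (metis \<sigma> inj(2) inj_onD prod.inject snd_conv)
  ultimately show "M \<subseteq> E \<and> (\<exists>\<sigma>. inj \<sigma> \<and> M = range (\<lambda>i. (i, \<sigma> i)))"
    using M by (auto simp: left_perfect_matching_def)
next
  assume "M \<subseteq> E \<and> (\<exists>\<sigma>. inj \<sigma> \<and> M = range (\<lambda>i. (i, \<sigma> i)))"
  then obtain \<sigma> where "M \<subseteq> E" "inj \<sigma>" "M = range (\<lambda>i. (i, \<sigma> i))" by blast
  moreover have "card (range (\<lambda>i. (i, \<sigma> i))) = CARD('n)"
    by (rule card_image) (simp add: inj_on_def)
  ultimately show "left_perfect_matching E M"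
    by (auto simp: left_perfect_matching_def dest: injD)
qed

lemma left_perfect_matching_mono:
  "left_perfect_matching D M \<Longrightarrow> D \<subseteq> E \<Longrightarrow> left_perfect_matching E M"
  by (auto simp: left_perfect_matching_def)

text \<open>
  From degrees to matchings, a left-node of degree \<open>l\<close> in a proper colouring with \<open>l\<close> colours has
  exactly one edge of each colour, which makes every colour class left-perfect.
\<close>

theorem union_of_disjoint_lpms_iff_degrees:
  fixes H :: "('n::finite \<times> 'm::finite) set"
  shows "union_of_disjoint_lpms l H \<longleftrightarrow>
    (\<forall>i. card (H `` {i}) = l) \<and> (\<forall>j. card (H\<inverse> `` {j}) \<le> l)"
proof
  assume "union_of_disjoint_lpms l H"
  then obtain M where M: "\<forall>k<l. left_perfect_matching H (M k)" "disjoint_family_on M {..<l}"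
      and H: "H = (\<Union>k<l. M k)"
    unfolding union_of_disjoint_lpms_def by blast
  obtain \<sigma> where \<sigma>: "\<And>k. k < l \<Longrightarrow> inj (\<sigma> k) \<and> M k = range (\<lambda>i. (i, \<sigma> k i))"
    using M(1) unfolding left_perfect_matching_iff by metis
  have "card (H `` {i}) = l" for i
  proof -
    have "H `` {i} = (\<lambda>k. \<sigma> k i) ` {..<l}" by (auto simp: H \<sigma>)
    moreover have "inj_on (\<lambda>k. \<sigma> k i) {..<l}"
    proof (rule inj_onI, rule ccontr)
      fix k k' assume k: "k \<in> {..<l}" "k' \<in> {..<l}" "\<sigma> k i = \<sigma> k' i" "k \<noteq> k'"
      then have "(i, \<sigma> k i) \<in> M k \<inter> M k'" using \<sigma> by auto
      then show False using M(2) k unfolding disjoint_family_on_def by blast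
    qed
    ultimately show ?thesis by (simp add: card_image)
  qed
  moreover have "card (H\<inverse> `` {j}) \<le> l" for j
  proof -
    have "H\<inverse> `` {j} = (\<Union>k<l. \<sigma> k -` {j})" by (auto simp: H \<sigma>)
    also have "card \<dots> \<le> (\<Sum>k<l. card (\<sigma> k -` {j}))" by (rule card_UN_le) simp
    also have "\<dots> \<le> (\<Sum>k<l. 1)"
      by (rule sum_mono) (use \<sigma> card_vimage_inj_on_le[of _ UNIV "{j}"] in fastforce)
    finally show ?thesis by simp
  qed
  ultimately show "(\<forall>i. card (H `` {i}) = l) \<and> (\<forall>j. card (H\<inverse> `` {j}) \<le> l)" by blast
next
  assume deg: "(\<forall>i. card (H `` {i}) = l) \<and> (\<forall>j. card (H\<inverse> `` {j}) \<le> l)"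
  then obtain c where c: "proper_edge_coloring l H c"
    using bipartite_edge_coloring[of H l] by auto
  note D = proper_edge_coloringD[OF c]
  define M where "M k = {e \<in> H. c e = k}" for k
  have "left_perfect_matching H (M k)" if "k < l" for k
  proof -
    have "\<exists>j. (i, j) \<in> M k" for i
    proof -
      have "inj_on (\<lambda>j. c (i, j)) (H `` {i})" using D(2) by (auto simp: inj_on_def)
      then have "(\<lambda>j. c (i, j)) ` (H `` {i}) = {..<l}"
        by (intro card_subset_eq) (use deg D(1) in \<open>auto simp: card_image\<close>)
      then have "k \<in> (\<lambda>j. c (i, j)) ` (H `` {i})" using that by simp
      then show ?thesis by (auto simp: M_def)
    qed
    then obtain \<sigma> where \<sigma>: "\<And>i. (i, \<sigma> i) \<in> M k" by metis
    have "M k = range (\<lambda>i. (i, \<sigma> i))" using \<sigma> D(2) by (fastforce simp: M_def)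
    moreover have "inj \<sigma>"
    proof (rule injI)
      fix x y assume "\<sigma> x = \<sigma> y"
      then show "x = y" using \<sigma>[of x] \<sigma>[of y] D(3)[of x "\<sigma> x" y] by (simp add: M_def)
    qed
    ultimately show ?thesis unfolding left_perfect_matching_iff by (auto simp: M_def)
  qed
  moreover have "disjoint_family_on M {..<l}" by (auto simp: disjoint_family_on_def M_def)
  moreover have "H = (\<Union>k<l. M k)" using D(1) by (auto simp: M_def)
  ultimately show "union_of_disjoint_lpms l H" unfolding union_of_disjoint_lpms_def by blast
qed

lemma contains_union_of_disjoint_lpms_iff:
  "(\<exists>H\<subseteq>E. union_of_disjoint_lpms l H) \<longleftrightarrow>
   (\<exists>M. (\<forall>i<l. left_perfect_matching E (M i)) \<and> disjoint_family_on M {..<l})"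
proof
  assume "\<exists>H\<subseteq>E. union_of_disjoint_lpms l H"
  then show "\<exists>M. (\<forall>i<l. left_perfect_matching E (M i)) \<and> disjoint_family_on M {..<l}"
    unfolding union_of_disjoint_lpms_def using left_perfect_matching_mono by blast
next
  assume "\<exists>M. (\<forall>i<l. left_perfect_matching E (M i)) \<and> disjoint_family_on M {..<l}"
  then obtain M where M: "\<forall>i<l. left_perfect_matching E (M i)" "disjoint_family_on M {..<l}"
    by blast
  have "left_perfect_matching (\<Union>i<l. M i) (M i)" if "i < l" for i
    using M(1) that unfolding left_perfect_matching_def by blast
  then have "union_of_disjoint_lpms l (\<Union>i<l. M i)"
    using M(2) unfolding union_of_disjoint_lpms_def by blast
  moreover have "(\<Union>i<l. M i) \<subseteq> E"
    using M(1) by (auto simp: left_perfect_matching_def)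
  ultimately show "\<exists>H\<subseteq>E. union_of_disjoint_lpms l H" by blast
qed

lemma contains_union_of_disjoint_lpms_antimono:
  assumes "H \<subseteq> E" "union_of_disjoint_lpms l H" "k \<le> l"
  shows "\<exists>H\<subseteq>E. union_of_disjoint_lpms k H"
proof -
  obtain M where "\<forall>i<l. left_perfect_matching E (M i)" "disjoint_family_on M {..<l}"
    using contains_union_of_disjoint_lpms_iff assms(1,2) by metis
  then have "\<forall>i<k. left_perfect_matching E (M i)" "disjoint_family_on M {..<k}"
    using assms(3) by (auto simp: disjoint_family_on_def)
  then show ?thesis unfolding contains_union_of_disjoint_lpms_iff by blast
qed

section \<open>Saturated flows\<close>

lemma arc_iff [simp]:
  "(Source, Left_Node i) \<in> arcs E"
  "(Right_Node j, Target) \<in> arcs E"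
  "(Left_Node i, Right_Node j) \<in> arcs E \<longleftrightarrow> (i, j) \<in> E"
  by (auto simp: arcs_def outer_arcs_def inner_arcs_def)

lemma arc_sets:
  "{v. (Source, v) \<in> arcs E} = range Left_Node"
  "{u. (u, Left_Node i) \<in> arcs E} = {Source}"
  "{w. (Left_Node i, w) \<in> arcs E} = Right_Node ` (E `` {i})"
  "{u. (u, Right_Node j) \<in> arcs E} = Left_Node ` (E\<inverse> `` {j})"
  "{w. (Right_Node j, w) \<in> arcs E} = {Target}"
  by (auto simp: arcs_def outer_arcs_def inner_arcs_def)

lemma is_flow_arcs_iff:
  fixes E :: "('n::finite \<times> 'm::finite) set"
  shows "is_flow (arcs E) Source Target c f \<longleftrightarrow>
    f \<in> arcs E \<rightarrow>\<^sub>E {0..} \<and> (\<forall>e\<in>arcs E. f e \<le> c e) \<and>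
    (\<forall>i. f (Source, Left_Node i) = (\<Sum>j\<in>E `` {i}. f (Left_Node i, Right_Node j))) \<and>
    (\<forall>j. (\<Sum>i\<in>E\<inverse> `` {j}. f (Left_Node i, Right_Node j)) = f (Right_Node j, Target))"
proof -
  have "(\<forall>v. v \<noteq> Source \<and> v \<noteq> Target \<longrightarrow> P v) \<longleftrightarrow>
      (\<forall>i. P (Left_Node i)) \<and> (\<forall>j. P (Right_Node j))" for P :: "('n, 'm) node \<Rightarrow> bool"
    by (metis node.distinct(3,5,7,9) node.exhaust)
  then show ?thesis
    by (simp add: is_flow_def arc_sets sum.reindex inj_on_def)
qed

lemma flow_value_arcs:
  fixes E :: "('n::finite \<times> 'm::finite) set"
  shows "flow_value (arcs E) Source f = (\<Sum>i\<in>UNIV. f (Source, Left_Node i))"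
  by (simp add: flow_value_def arc_sets sum.reindex inj_on_def)

lemma capacity_arcs [simp]:
  "capacity l (Source, Left_Node i) = real l"
  "capacity l (Right_Node j, Target) = real l"
  "capacity l (Left_Node i, Right_Node j) = 1"
  by (auto simp: capacity_def outer_arcs_def)

text \<open>
  The value \<open>n * l\<close> is the sum of the \<open>n\<close> capacities at the source, so a saturated flow uses each of
  them fully; flow conservation turns this into the degree condition on the induced graph.
\<close>

lemma saturated_flow_induces_lpms:
  fixes E :: "('n::finite \<times> 'm::finite) set"
  assumes f: "f \<in> saturated_flows E l"
  shows "union_of_disjoint_lpms l (induced_graph E f)"
proof -
  let ?H = "induced_graph E f"
  have flow: "is_flow (arcs E) Source Target (capacity l) f"
    and int: "\<And>e. e \<in> arcs E \<Longrightarrow> f e \<in> \<int>"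
    and val: "(\<Sum>i\<in>UNIV. f (Source, Left_Node i)) = real (CARD('n) * l)"
    using f by (auto simp: saturated_flows_def integer_flows_def flow_value_arcs)
  have nonneg: "f e \<ge> 0" and cap: "f e \<le> capacity l e" if "e \<in> arcs E" for e
    using flow that by (auto simp: is_flow_def)
  have unit: "f (Left_Node i, Right_Node j) = (if (i, j) \<in> ?H then 1 else 0)" if "(i, j) \<in> E" for i j
  proof -
    have "f (Left_Node i, Right_Node j) \<in> \<int>" "0 \<le> f (Left_Node i, Right_Node j)"
        "f (Left_Node i, Right_Node j) \<le> 1"
      using that int[of "(Left_Node i, Right_Node j)"] nonneg[of "(Left_Node i, Right_Node j)"]
        cap[of "(Left_Node i, Right_Node j)"] by auto
    then have "f (Left_Node i, Right_Node j) = 0 \<or> f (Left_Node i, Right_Node j) = 1"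
      by (auto elim!: Ints_cases)
    then show ?thesis using that by (auto simp: induced_graph_def)
  qed
  have HE: "?H \<subseteq> E" by (auto simp: induced_graph_def)
  have outd: "f (Source, Left_Node i) = real (card (?H `` {i}))" for i
  proof -
    have "f (Source, Left_Node i) = (\<Sum>j\<in>E `` {i}. f (Left_Node i, Right_Node j))"
      using flow by (simp add: is_flow_arcs_iff)
    also have "\<dots> = (\<Sum>j\<in>?H `` {i}. 1)"
      by (rule sum.mono_neutral_cong_right) (use HE in \<open>auto simp: unit\<close>)
    finally show ?thesis by simp
  qed
  have ind: "f (Right_Node j, Target) = real (card (?H\<inverse> `` {j}))" for j
  proof -
    have "f (Right_Node j, Target) = (\<Sum>i\<in>E\<inverse> `` {j}. f (Left_Node i, Right_Node j))"
      using flow by (simp add: is_flow_arcs_iff)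
    also have "\<dots> = (\<Sum>i\<in>?H\<inverse> `` {j}. 1)"
      by (rule sum.mono_neutral_cong_right) (use HE in \<open>auto simp: unit\<close>)
    finally show ?thesis by simp
  qed
  \<comment> \<open>The unused capacities at the source are nonnegative and sum to zero.\<close>
  have "f (Source, Left_Node i) = real l" for i
  proof -
    have "(\<Sum>i\<in>(UNIV :: 'n set). real l - f (Source, Left_Node i)) = 0"
      using val by (simp add: sum_subtractf)
    moreover have "\<forall>i. real l - f (Source, Left_Node i) \<ge> 0"
      using cap[of "(Source, Left_Node _)"] by simp
    ultimately show ?thesis by (subst (asm) sum_nonneg_eq_0_iff) auto
  qed
  moreover have "f (Right_Node j, Target) \<le> real l" for j
    using cap[of "(Right_Node j, Target)"] by simp
  ultimately show ?thesis
    by (simp add: union_of_disjoint_lpms_iff_degrees outd ind)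
qed

text \<open>
  The indicator function of \<open>H\<close> on the inner arcs extends to a flow by the degrees of \<open>H\<close> on the
  outer arcs.
\<close>

lemma saturated_flow_of_lpms:
  fixes E :: "('n::finite \<times> 'm::finite) set"
  assumes "H \<subseteq> E" "union_of_disjoint_lpms l H"
  shows "saturated_flows E l \<noteq> {}"
proof -
  have deg: "card (H `` {i}) = l" "card (H\<inverse> `` {j}) \<le> l" for i j
    using assms(2) by (auto simp: union_of_disjoint_lpms_iff_degrees)
  define g :: "('n, 'm) node \<times> ('n, 'm) node \<Rightarrow> nat" where
    "g = (\<lambda>(u, v). case v of
        Left_Node i \<Rightarrow> l
      | Right_Node j \<Rightarrow> (case u of Left_Node i \<Rightarrow> if (i, j) \<in> H then 1 else 0 | _ \<Rightarrow> 0)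
      | _ \<Rightarrow> (case u of Right_Node j \<Rightarrow> card (H\<inverse> `` {j}) | _ \<Rightarrow> 0))"
  define f where "f = restrict (\<lambda>e. real (g e)) (arcs E)"
  have f [simp]: "f (Source, Left_Node i) = real l"
      "f (Right_Node j, Target) = real (card (H\<inverse> `` {j}))"
      "(i, j) \<in> E \<Longrightarrow> f (Left_Node i, Right_Node j) = (if (i, j) \<in> H then 1 else 0)" for i j
    by (simp_all add: f_def g_def)
  have "(\<Sum>j\<in>E `` {i}. f (Left_Node i, Right_Node j)) = (\<Sum>j\<in>H `` {i}. 1)" for i
    by (rule sum.mono_neutral_cong_right) (use assms(1) in auto)
  moreover have "(\<Sum>i\<in>E\<inverse> `` {j}. f (Left_Node i, Right_Node j)) = (\<Sum>i\<in>H\<inverse> `` {j}. 1)" for j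
    by (rule sum.mono_neutral_cong_right) (use assms(1) in auto)
  moreover have "f e \<le> capacity l e" if "e \<in> arcs E" for e
    using that deg(2) by (auto simp: arcs_def outer_arcs_def inner_arcs_def)
  moreover have "f \<in> arcs E \<rightarrow>\<^sub>E {0..}" by (auto simp: f_def)
  ultimately have "is_flow (arcs E) Source Target (capacity l) f"
    by (simp add: is_flow_arcs_iff deg(1))
  moreover have "\<forall>e\<in>arcs E. f e \<in> \<int>" by (simp add: f_def)
  moreover have "flow_value (arcs E) Source f = real (CARD('n) * l)"
    by (simp add: flow_value_arcs)
  ultimately have "f \<in> saturated_flows E l"
    by (simp add: saturated_flows_def integer_flows_def)
  then show ?thesis by blast
qed

corollary saturated_level_iff:
  "l \<in> saturated_levels E \<longleftrightarrow> (\<exists>H\<subseteq>E. union_of_disjoint_lpms l H)"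
proof
  assume "l \<in> saturated_levels E"
  then obtain f where "f \<in> saturated_flows E l" by (auto simp: saturated_levels_def)
  then have "union_of_disjoint_lpms l (induced_graph E f)" by (rule saturated_flow_induces_lpms)
  moreover have "induced_graph E f \<subseteq> E" by (auto simp: induced_graph_def)
  ultimately show "\<exists>H\<subseteq>E. union_of_disjoint_lpms l H" by blast
qed (auto simp: saturated_levels_def dest: saturated_flow_of_lpms)

lemma saturated_levels_eq_atMost:
  fixes E :: "('n::finite \<times> 'm::finite) set"
  shows "ell_star E \<le> CARD('m)" and "saturated_levels E = {..ell_star E}"
proof -
  let ?L = "saturated_levels E"
  have bound: "l \<le> CARD('m)" if l: "l \<in> ?L" for l
  proof -
    obtain H :: "('n \<times> 'm) set" where "union_of_disjoint_lpms l H"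
      using l unfolding saturated_level_iff by blast
    then have "card (H `` {i}) = l" for i by (simp add: union_of_disjoint_lpms_iff_degrees)
    then show ?thesis by (metis card_mono finite subset_UNIV)
  qed
  have "union_of_disjoint_lpms 0 ({} :: ('n \<times> 'm) set)"
    by (simp add: union_of_disjoint_lpms_iff_degrees)
  then have "0 \<in> ?L" unfolding saturated_level_iff by blast
  moreover have "?L \<subseteq> {..CARD('m)}" using bound by blast
  then have fin: "finite ?L" by (rule finite_subset) simp
  ultimately have "ell_star E \<in> ?L" unfolding ell_star_def by (intro Max_in) auto
  then show "ell_star E \<le> CARD('m)" by (rule bound)
  have "l \<in> ?L" if "l \<le> ell_star E" for l
    using \<open>ell_star E \<in> ?L\<close> contains_union_of_disjoint_lpms_antimono that
    unfolding saturated_level_iff by metis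
  moreover have "l \<le> ell_star E" if "l \<in> ?L" for l
    unfolding ell_star_def using that fin by simp
  ultimately show "?L = {..ell_star E}" by blast
qed

section \<open>Rank of a sparsity pattern\<close>

text \<open>
  Some \<open>n\<close> columns of a matrix of rank \<open>n\<close> are linearly independent; they form a square matrix with
  nonzero determinant, and a nonzero term of its Leibniz expansion is the transversal.
\<close>

lemma full_row_rank_transversal:
  fixes A :: "real^'m^'n"
  assumes "rank A = CARD('n)"
  shows "\<exists>\<sigma>. inj \<sigma> \<and> (\<forall>i. A $ i $ \<sigma> i \<noteq> 0)"
proof -
  obtain B where B: "B \<subseteq> columns A" "independent B" "columns A \<subseteq> span B" "card B = dim (columns A)"
    by (meson basis_exists)
  have "finite B" using B(2) by (rule independent_imp_finite)
  moreover have cardB: "card B = CARD('n)" using B(4) assms by (simp add: column_rank_def)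
  ultimately obtain h where h: "bij_betw h (UNIV :: 'n set) B"
    by (metis finite finite_same_card_bij)
  have "\<exists>j. h k = column j A" for k
    using bij_betwE[OF h] B(1) unfolding columns_def by blast
  then obtain g where g: "\<And>k. h k = column (g k) A" by metis
  define A' :: "real^'n^'n" where "A' = (\<chi> i k. A $ i $ g k)"
  have "columns A' = B"
  proof -
    have "column k A' = h k" for k by (simp add: g column_def A'_def)
    then have "columns A' = range h" by (auto simp: columns_def)
    then show ?thesis using h by (simp add: bij_betw_def)
  qed
  then have "rank A' = CARD('n)"
    using B(2) cardB by (simp add: column_rank_def dim_eq_card_independent)
  then have "det A' \<noteq> 0" by (simp add: det_eq_0_rank)
  then obtain p where p: "p permutes UNIV" "(\<Prod>i\<in>UNIV. A' $ i $ p i) \<noteq> 0"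
    unfolding det_def by (auto elim!: sum.not_neutral_contains_not_neutral)
  have "inj g" using h g by (metis bij_betw_imp_inj_on injD injI)
  then have "inj (\<lambda>i. g (p i))" using permutes_inj[OF p(1)] by (auto simp: inj_def)
  moreover have "A $ i $ g (p i) \<noteq> 0" for i
    using p(2) by (auto simp: A'_def)
  ultimately show ?thesis by blast
qed

text \<open>The facts under which the maximum that defines the rank of a pattern can be evaluated.\<close>

lemma rank_image_bounded:
  fixes S :: "(real^'m^'n) set"
  shows "finite (rank ` S)" and "x \<in> rank ` S \<Longrightarrow> x \<le> CARD('n)"
proof -
  have *: "rank A \<le> CARD('n)" for A :: "real^'m^'n" using rank_bound[of A] by simp
  show "x \<in> rank ` S \<Longrightarrow> x \<le> CARD('n)" using * by auto
  show "finite (rank ` S)" by (rule finite_subset[of _ "{..CARD('n)}"]) (use * in auto)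
qed

text \<open>
  The nonzero transversal of a matrix of rank \<open>n\<close> can only use positions in \<open>D\<close>; conversely,
  the 0-1 matrix of a left-perfect matching \<open>\<sigma>\<close> maps \<open>x\<close> to \<open>x \<circ> \<sigma>\<close>, which is surjective because
  \<open>\<sigma>\<close> is injective.
\<close>

theorem pattern_rank_full_iff:
  fixes D :: "('n::finite \<times> 'm::finite) set"
  shows "pattern_rank (pattern_of_graph D) = CARD('n) \<longleftrightarrow> (\<exists>M. left_perfect_matching D M)"
proof
  assume full: "pattern_rank (pattern_of_graph D) = CARD('n)"
  have "pattern_of_graph D \<noteq> {}" unfolding pattern_of_graph_def using span_zero by blast
  then have "CARD('n) \<in> rank ` pattern_of_graph D"
    using Max_in[OF rank_image_bounded(1), of "pattern_of_graph D"] full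
    unfolding pattern_rank_def by simp
  then obtain A where A: "A \<in> pattern_of_graph D" "rank A = CARD('n)"
    by (metis imageE)
  obtain \<sigma> where \<sigma>: "inj \<sigma>" "\<And>i. A $ i $ \<sigma> i \<noteq> 0"
    using full_row_rank_transversal[OF A(2)] by blast
  have "(i, \<sigma> i) \<in> D" for i
  proof (rule ccontr)
    assume "(i, \<sigma> i) \<notin> D"
    then have "pattern_of_graph D \<subseteq> {A. A $ i $ \<sigma> i = 0}"
      unfolding pattern_of_graph_def
      by (intro span_minimal) (auto simp: unit_matrix_def subspace_def)
    then show False using A(1) \<sigma>(2) by blast
  qed
  then have "left_perfect_matching D (range (\<lambda>i. (i, \<sigma> i)))"
    unfolding left_perfect_matching_iff using \<sigma>(1) by blast
  then show "\<exists>M. left_perfect_matching D M" by blast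
next
  assume "\<exists>M. left_perfect_matching D M"
  then obtain \<sigma> where \<sigma>: "inj \<sigma>" "\<And>i. (i, \<sigma> i) \<in> D"
    unfolding left_perfect_matching_iff by blast
  define A :: "real^'m^'n" where "A = (\<Sum>i\<in>UNIV. unit_matrix (i, \<sigma> i))"
  have A: "A \<in> pattern_of_graph D"
    unfolding A_def pattern_of_graph_def using \<sigma>(2) by (intro span_sum span_base) auto
  have entry: "A $ i $ j = (if j = \<sigma> i then 1 else 0)" for i j
  proof -
    have "A $ i $ j = (\<Sum>k\<in>UNIV. if k = i then (if j = \<sigma> i then 1 else 0) else 0)"
      unfolding A_def sum_component by (rule sum.cong) (auto simp: unit_matrix_def)
    then show ?thesis by simp
  qed
  have "surj ((*v) A)"
  proof (rule surjI)
    fix y :: "real^'n"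
    have "(A *v x) $ i = x $ \<sigma> i" for x i
      by (simp add: matrix_vector_mult_def entry if_distrib[of "\<lambda>a. a * _"] cong: if_cong)
    then show "A *v (\<chi> j. y $ inv \<sigma> j) = y"
      by (simp add: vec_eq_iff \<sigma>(1))
  qed
  then have "CARD('n) \<in> rank ` pattern_of_graph D"
    using A full_rank_surjective by (metis image_eqI)
  then show "pattern_rank (pattern_of_graph D) = CARD('n)"
    unfolding pattern_rank_def using rank_image_bounded by (intro Max_eqI) auto
qed

lemma pattern_rank_le:
  fixes D :: "('n::finite \<times> 'm::finite) set"
  shows "pattern_rank (pattern_of_graph D) \<le> CARD('n)"
proof -
  have "pattern_of_graph D \<noteq> {}" unfolding pattern_of_graph_def using span_zero by blast
  then show ?thesis
    unfolding pattern_rank_def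
    using Max_in[OF rank_image_bounded(1), of "pattern_of_graph D"] rank_image_bounded(2) by auto
qed

section \<open>Zero-resilient summands\<close>

text \<open>
  The witness for 0-resilience removes any edge at all: fewer than \<open>n\<close> edges cannot contain a
  left-perfect matching, so the rank drops.
\<close>

lemma zero_resilient_of_lpm:
  fixes M :: "('n::finite \<times> 'm::finite) set"
  assumes "left_perfect_matching E M"
  shows "zero_resilient (pattern_of_graph M)"
proof -
  have M: "left_perfect_matching M M" and card: "card M = CARD('n)"
    using assms by (auto simp: left_perfect_matching_def)
  then have "M \<noteq> {}" by auto
  then obtain e where e: "e \<in> M" by blast
  have less: "card (M - {e}) + 1 = card M" using e card by simp
  have "\<not> left_perfect_matching (M - {e}) N" for N
    using card_mono[of "M - {e}" N] less card by (auto simp: left_perfect_matching_def)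
  then have "pattern_rank (pattern_of_graph (M - {e})) < CARD('n)"
    using pattern_rank_full_iff[of "M - {e}"] pattern_rank_le[of "M - {e}"] by fastforce
  moreover have "pattern_rank (pattern_of_graph M) = CARD('n)"
    using M pattern_rank_full_iff by blast
  ultimately show ?thesis
    unfolding zero_resilient_def
    using less sparsity_pattern_pattern_of_graph index_set_pattern_of_graph
    by (metis Diff_subset)
qed

lemma zero_resilient_imp_lpm:
  assumes "zero_resilient P"
  shows "\<exists>M. left_perfect_matching (index_set P) M"
  using assms pattern_of_graph_unique[of P "index_set P"] pattern_rank_full_iff[of "index_set P"]
  by (simp add: zero_resilient_def)

text \<open>
  Each 0-resilient summand has rank \<open>n\<close> and thus contains a left-perfect matching, and disjoint index
  sets give disjoint matchings. Conversely, each matching spans a summand of its own.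
\<close>

theorem contains_zero_resilient_sum_iff:
  fixes E :: "('n::finite \<times> 'm::finite) set"
  shows "contains_zero_resilient_sum q (pattern_of_graph E) \<longleftrightarrow>
    (\<exists>H\<subseteq>E. union_of_disjoint_lpms q H)"
proof
  assume "contains_zero_resilient_sum q (pattern_of_graph E)"
  then obtain P where P: "\<forall>i<q. zero_resilient (P i)"
      "disjoint_family_on (\<lambda>i. index_set (P i)) {..<q}"
      "{\<Sum>i<q. x i | x. \<forall>i<q. x i \<in> P i} \<subseteq> pattern_of_graph E"
    unfolding contains_zero_resilient_sum_def by blast
  have sub: "index_set (P i) \<subseteq> E" if "i < q" for i
  proof -
    \<comment> \<open>A single summand lies in the sum: take the zero matrix from all the others.\<close>
    have "A \<in> pattern_of_graph E" if "A \<in> P i" for A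
    proof -
      define x where "x k = (if k = i then A else 0)" for k
      have "\<forall>k<q. x k \<in> P k"
        using P(1) that by (auto simp: x_def zero_resilient_def sparsity_pattern_def subspace_0)
      then have "(\<Sum>k<q. x k) \<in> pattern_of_graph E" using P(3) by blast
      then show ?thesis using \<open>i < q\<close> by (simp add: x_def)
    qed
    then have "index_set (P i) \<subseteq> index_set (pattern_of_graph E)" by (auto simp: index_set_def)
    then show ?thesis by (simp add: index_set_pattern_of_graph)
  qed
  have "\<forall>i. \<exists>M. i < q \<longrightarrow> left_perfect_matching (index_set (P i)) M"
    using P(1) zero_resilient_imp_lpm by blast
  then obtain M where M: "\<And>i. i < q \<Longrightarrow> left_perfect_matching (index_set (P i)) (M i)"
    by metis
  have "M i \<subseteq> index_set (P i)" if "i < q" for i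
    using M[OF that] by (simp add: left_perfect_matching_def)
  then have "disjoint_family_on M {..<q}"
    using P(2) unfolding disjoint_family_on_def by blast
  moreover have "\<forall>i<q. left_perfect_matching E (M i)"
    using M sub left_perfect_matching_mono by blast
  ultimately show "\<exists>H\<subseteq>E. union_of_disjoint_lpms q H"
    unfolding contains_union_of_disjoint_lpms_iff by blast
next
  assume "\<exists>H\<subseteq>E. union_of_disjoint_lpms q H"
  then obtain M where M: "\<forall>i<q. left_perfect_matching E (M i)" "disjoint_family_on M {..<q}"
    unfolding contains_union_of_disjoint_lpms_iff by blast
  have "pattern_of_graph (M i) \<subseteq> pattern_of_graph E" if "i < q" for i
    unfolding pattern_of_graph_def
    using M(1) that by (intro span_mono image_mono) (auto simp: left_perfect_matching_def)
  then have "{\<Sum>i<q. x i | x. \<forall>i<q. x i \<in> pattern_of_graph (M i)} \<subseteq> pattern_of_graph E"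
    by (auto simp: pattern_of_graph_def intro!: span_sum)
  then show "contains_zero_resilient_sum q (pattern_of_graph E)"
    unfolding contains_zero_resilient_sum_def
    using M zero_resilient_of_lpm[of E]
    by (intro exI[of _ "\<lambda>i. pattern_of_graph (M i)"]) (simp add: index_set_pattern_of_graph)
qed

text \<open>
  The degree is one less than the largest number of summands. For \<open>ell_star E = 0\<close> there is no
  left-perfect matching and the rank is below \<open>n\<close>, so the conventional degree -1 continues the formula.
\<close>

theorem strong_resilience_degree_ell_star:
  fixes E :: "('n::finite \<times> 'm::finite) set"
  shows "graph_has_strong_resilience_degree E (int (ell_star E) - 1)"
proof -
  have sums: "contains_zero_resilient_sum q (pattern_of_graph E) \<longleftrightarrow> q \<le> ell_star E" for q
    using saturated_levels_eq_atMost(2)[of E]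
    by (auto simp flip: saturated_level_iff simp: contains_zero_resilient_sum_iff)
  have "(\<exists>M. left_perfect_matching E M) \<longleftrightarrow> (\<exists>H\<subseteq>E. union_of_disjoint_lpms 1 H)"
    unfolding contains_union_of_disjoint_lpms_iff by (auto simp: disjoint_family_on_def)
  also have "\<dots> \<longleftrightarrow> ell_star E \<ge> 1"
    using sums contains_zero_resilient_sum_iff by metis
  finally have "pattern_rank (pattern_of_graph E) < CARD('n) \<longleftrightarrow> ell_star E = 0"
    using pattern_rank_full_iff[of E] pattern_rank_le[of E] by (metis less_one linorder_not_less nat_less_le)
  then show ?thesis
    by (auto simp: graph_has_strong_resilience_degree_def has_strong_resilience_degree_def sums)
qed

section \<open>Flows and the degree of strong resilience\<close>

theorem theorem3:
  fixes E :: "('n::finite \<times> 'm::finite) set"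
  assumes "CARD('m) \<ge> CARD('n)"
  shows "finite (saturated_levels E) \<and> saturated_levels E \<noteq> {} \<and>
    ell_star E \<le> CARD('m) \<and>
    (ell_star E \<ge> 0 \<longrightarrow>
       (\<forall>l. 0 \<le> l \<and> l \<le> ell_star E \<longrightarrow>
          saturated_flows E l \<noteq> {} \<and>
          (\<forall>f\<in>saturated_flows E l. union_of_disjoint_lpms l (induced_graph E f)))) \<and>
    graph_has_strong_resilience_degree E (int (ell_star E) - 1)"
proof -
  have "saturated_flows E l \<noteq> {}" if "l \<le> ell_star E" for l
    using that saturated_levels_eq_atMost(2)[of E] by (auto simp: saturated_levels_def)
  then show ?thesis
    using saturated_levels_eq_atMost[of E] saturated_flow_induces_lpms
      strong_resilience_degree_ell_star[of E]
    by auto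
qed

end
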